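(* Let $\mathcal F$ be the family of self-dual codes of length $N=2n$ of a given Type over a finite field $\mathbb F$, and let $\mathcal V$ be the associated Hermitian space (see context). For every $0\le k\le n$ the $k$-th Kneser-Hecke-operator $T_k$ is a self-adjoint linear operator on $\mathcal V$, i.e. $(T_k(v),w)=(v,T_k(w))$ for all $v,w\in\mathcal V$.
   Context: Form. $\mathbb F$ is a finite field of characteristic $p$, $N=2n$ is a positive even integer, and $b(x,y)=\sum_{i=1}^N x_i\overline{y_i}$ on $\mathbb F^N$, where $\overline{\phantom{s}}$ is either the identity (bilinear case) or a field automorphism of $\mathbb F$ of order 2 (Hermitian case). $C^\perp$ is the orthogonal space of a subspace $C\le\mathbb F^N$ with respect to $b$; $C$ is self-dual if $C=C^\perp$ (then $\dim C=n$). Type. For $r\in\mathbb F$ let $m_r:\mathbb F\times\mathbb F\to\mathbb Q/\mathbb Z$, $m_r(x,y)=\frac1p\operatorname{Tr}_{\mathbb F/\mathbb F_p}(r x\overline{y})$. A Type (for the given $\mathbb F$ and $\overline{\phantom{s}}$) is specified by an additive group $\Phi$ of maps $\varphi:\mathbb F\to\mathbb Q/\mathbb Z$ with $\varphi(0)=0$ such that: for each $\varphi\in\Phi$ the map $(x,y)\mapsto\varphi(x+y)-\varphi(x)-\varphi(y)$ equals $m_r$ for some $r\in\mathbb F$; for $\varphi\in\Phi$, $r\in\mathbb F$ the map $x\mapsto\varphi(rx)$ is in $\Phi$; and $x\mapsto m_r(x,x)$ is in $\Phi$ for all $r\in\mathbb F$. The family $\mathcal F$ of self-dual codes of length $N$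 of this Type is the set of all $\mathbb F$-subspaces $C\le\mathbb F^N$ with $C=C^\perp$ and $\sum_{i=1}^N\varphi(c_i)=0$ for all $c\in C$, $\varphi\in\Phi$. Vector space. Two codes are equivalent if a coordinate permutation in $S_N$ maps one onto the other; $[C]$ is the equivalence class of $C$; $\operatorname{Aut}(C)=\{\pi\in S_N:\pi(C)=C\}$. $\mathcal V$ is the $\mathbb C$-vector space with basis $\mathcal B=\{[C]:C\in\mathcal F\}$, with the positive definite Hermitian scalar product given by $([C],[D])=|\operatorname{Aut}(C)|\,\delta_{[C],[D]}$. Operators. For $0\le k\le n$, codes $C,D\in\mathcal F$ are $k$-neighbors, written $C\sim_k D$, if $\dim(C\cap D)=\dim(C)-k$. $T_k$ is the linear operator on $\mathcal V$ with $T_k([C])=\sum_{D\in\mathcal F,\,D\sim_k C}[D]$. *)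

theory Defs
  imports
    "HOL-Analysis.Analysis"
    "HOL-Computational_Algebra.Primes"
    "HOL-Combinatorics.Permutations"
begin

section \<open>The group of rationals modulo the integers\<close>

quotient_type ratmodint = rat / "\<lambda>x y. x - y \<in> \<int>"
  morphisms rep_ratmodint ratmodint_of
proof (rule equivpI)
  show "reflp (\<lambda>x y::rat. x - y \<in> \<int>)"
    by (simp add: reflp_def)
  show "symp (\<lambda>x y::rat. x - y \<in> \<int>)"
    by (rule sympI) (metis Ints_minus minus_diff_eq)
  show "transp (\<lambda>x y::rat. x - y \<in> \<int>)"
  proof (rule transpI)
    fix x y z :: rat
    assume "x - y \<in> \<int>" "y - z \<in> \<int>"
    then have "(x - y) + (y - z) \<in> \<int>" by (rule Ints_add)
    then show "x - z \<in> \<int>" by simp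
  qed
qed

instantiation ratmodint :: ab_group_add
begin

lift_definition zero_ratmodint :: ratmodint is "0 :: rat" .

lift_definition plus_ratmodint :: "ratmodint \<Rightarrow> ratmodint \<Rightarrow> ratmodint" is "(+) :: rat \<Rightarrow> rat \<Rightarrow> rat"
proof -
  fix a b c d :: rat
  assume "a - b \<in> \<int>" "c - d \<in> \<int>"
  then have "(a - b) + (c - d) \<in> \<int>" by (rule Ints_add)
  then show "(a + c) - (b + d) \<in> \<int>" by (simp add: algebra_simps)
qed

lift_definition uminus_ratmodint :: "ratmodint \<Rightarrow> ratmodint" is "uminus :: rat \<Rightarrow> rat"
proof -
  fix a b :: rat
  assume "a - b \<in> \<int>"
  then have "- (a - b) \<in> \<int>" by (rule Ints_minus)
  then show "- a - - b \<in> \<int>" by simp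
qed

lift_definition minus_ratmodint :: "ratmodint \<Rightarrow> ratmodint \<Rightarrow> ratmodint" is "(-) :: rat \<Rightarrow> rat \<Rightarrow> rat"
proof -
  fix a b c d :: rat
  assume "a - b \<in> \<int>" "c - d \<in> \<int>"
  then have "(a - b) - (c - d) \<in> \<int>" by (rule Ints_diff)
  then show "(a - c) - (b - d) \<in> \<int>" by (simp add: algebra_simps)
qed

instance
  by standard (transfer; simp add: algebra_simps)+

end


section \<open>The trace to the prime field\<close>

text \<open>
  The trace is the sum of the Galois conjugates, i.e. of the images under the powers of the
  Frobenius automorphism; it is an element of the prime field sitting inside \<open>'f\<close>.
\<close>

definition prime_degree :: "'f::finite_field itself \<Rightarrow> nat" where
  "prime_degree _ = (THE m. CARD('f) = CHAR('f) ^ m)"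

definition prime_trace :: "'f::finite_field \<Rightarrow> 'f" where
  "prime_trace x = (\<Sum>i<prime_degree TYPE('f). x ^ (CHAR('f) ^ i))"

text \<open>
  The identification of the prime field with the integers modulo \<open>p\<close>, followed by division by
  \<open>p\<close>. An element \<open>t\<close> of the prime field determines the integer \<open>k\<close> modulo \<open>p\<close>, hence
  \<open>k / p\<close> modulo the integers.
\<close>

definition prime_field_over_p :: "'f::finite_field \<Rightarrow> ratmodint" where
  "prime_field_over_p t =
     ratmodint_of (of_int (SOME k::int. of_int k = t) / of_nat CHAR('f))"

definition trace_form :: "('f \<Rightarrow> 'f) \<Rightarrow> 'f \<Rightarrow> 'f::finite_field \<Rightarrow> 'f \<Rightarrow> ratmodint" where
  "trace_form bar r x y = prime_field_over_p (prime_trace (r * x * bar y))"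

lemma card_finite_field_prime_power:
  "\<exists>m. CARD('f::finite_field) = CHAR('f) ^ m"
proof -
  define p where "p = CHAR('f)"
  have p: "prime p" unfolding p_def by simp
  define sg :: "'f set \<Rightarrow> bool" where
    "sg S \<longleftrightarrow> 0 \<in> S \<and> (\<forall>x\<in>S. \<forall>y\<in>S. x - y \<in> S)" for S
  define Q where "Q S \<longleftrightarrow> sg S \<and> (\<exists>m. card S = p ^ m)" for S
  have Q0: "Q {0}" unfolding Q_def sg_def by (auto intro: exI[of _ 0])
  have fin: "finite {S. Q S}" by simp
  have ne: "{S. Q S} \<noteq> {}" using Q0 by blast
  obtain S where S: "Q S" and mx: "\<And>T. Q T \<Longrightarrow> S \<subseteq> T \<Longrightarrow> S = T"
    using finite_has_maximal[OF fin ne] by blast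
  have sgS: "sg S" using S Q_def by blast
  have S0: "0 \<in> S" and Sd: "\<And>x y. x \<in> S \<Longrightarrow> y \<in> S \<Longrightarrow> x - y \<in> S"
    using sgS unfolding sg_def by auto
  have Sm: "- x \<in> S" if "x \<in> S" for x using Sd[OF S0 that] by simp
  have Sa: "x + y \<in> S" if "x \<in> S" "y \<in> S" for x y
    using Sd[OF that(1) Sm[OF that(2)]] by simp
  have Sn: "of_nat k * x \<in> S" if "x \<in> S" for k x
    by (induction k) (use S0 Sa that in \<open>auto simp: algebra_simps\<close>)
  have Si: "of_int k * x \<in> S" if "x \<in> S" for k x
    by (cases k) (use Sn[OF that] Sm in \<open>auto simp: minus_mult_left[symmetric] simp del: of_nat_Suc\<close>)
  have "S = UNIV"
  proof (rule ccontr)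
    assume "S \<noteq> UNIV"
    then obtain x where x: "x \<notin> S" by blast
    define T where "T = (\<lambda>(s, k). s + of_nat k * x) ` (S \<times> {..<p})"
    have T_alt: "s + of_int k * x \<in> T" if "s \<in> S" for s k
    proof -
      have "k = int p * (k div int p) + int (nat (k mod int p))"
        using prime_gt_0_nat[OF p] by simp
      then have "(of_int k :: 'f) = of_int (int p * (k div int p) + int (nat (k mod int p)))"
        by (rule arg_cong)
      then have "(of_int k :: 'f) = of_nat (nat (k mod int p))"
        by (simp only: of_int_add of_int_mult of_int_of_nat_eq) (simp add: p_def)
      moreover have "nat (k mod int p) < p"
        using prime_gt_0_nat[OF p] by (simp add: nat_less_iff)
      ultimately show ?thesis unfolding T_def using that by force
    qed
    have inj: "inj_on (\<lambda>(s, k). s + of_nat k * x) (S \<times> {..<p})"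
    proof (rule inj_onI, clarsimp)
      fix s k t l
      assume *: "s \<in> S" "k < p" "t \<in> S" "l < p" "s + of_nat k * x = t + of_nat l * x"
      have kl: "k = l"
      proof (rule ccontr)
        assume "k \<noteq> l"
        then have "\<not> int p dvd int k - int l"
          using * zdvd_not_zless[of "int k - int l" "int p"] zdvd_not_zless[of "int l - int k" "int p"]
          by (metis diff_gt_0_iff_gt dvd_diff_commute linorder_neqE_nat of_nat_0_le_iff of_nat_less_iff
              diff_left_mono diff_zero order_le_less_trans)
        then have nz: "(of_int (int k - int l) :: 'f) \<noteq> 0"
          unfolding p_def by (metis of_int_eq_0_iff_char_dvd)
        have "coprime (int k - int l) (int p)"
          using \<open>\<not> int p dvd int k - int l\<close> p
          by (metis coprime_commute prime_imp_coprime prime_nat_int_transfer)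
        then obtain u v where uv: "u * (int k - int l) + v * int p = 1"
          by (metis bezout_int coprime_imp_gcd_eq_1)
        have "(of_int (u * (int k - int l) + v * int p) :: 'f) = 1"
          by (simp only: uv of_int_1)
        then have "of_int u * of_int (int k - int l) = (1 :: 'f)"
          by (simp add: p_def)
        moreover have "of_int (int k - int l) * x = t - s"
          using *(5) by (simp add: algebra_simps)
        ultimately have "x = of_int u * (t - s)" by (metis mult.assoc mult_1)
        then show False using Si[OF Sd[OF *(3,1)]] x by simp
      qed
      then show "s = t \<and> k = l" using * by simp
    qed
    have "sg T"
      unfolding sg_def
    proof (intro conjI ballI)
      show "0 \<in> T" using T_alt[OF S0, of 0] by simp
      fix a b assume "a \<in> T" "b \<in> T"
      then obtain s k t l where ab: "s \<in> S" "t \<in> S" "a = s + of_nat k * x" "b = t + of_nat l * x"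
        unfolding T_def by auto
      have "a - b = (s - t) + of_int (int k - int l) * x"
        using ab by (simp add: algebra_simps)
      then show "a - b \<in> T" using T_alt[OF Sd[OF ab(1,2)], of "int k - int l"] by (simp only:)
    qed
    moreover have "\<exists>m. card T = p ^ m"
    proof -
      obtain m where "card S = p ^ m" using S Q_def by blast
      then have "card T = p ^ Suc m"
        unfolding T_def by (simp add: card_image[OF inj] card_cartesian_product)
      then show ?thesis by blast
    qed
    ultimately have "Q T" unfolding Q_def by blast
    moreover have "S \<subseteq> T" using T_alt[of _ 0] by auto
    ultimately have "S = T" using mx by blast
    moreover have "x \<in> T" using T_alt[OF S0, of 1] by simp
    ultimately show False using x by blast
  qed
  then show ?thesis using S unfolding Q_def p_def by simp
qed

lemma card_finite_field: "CARD('f::finite_field) = CHAR('f) ^ prime_degree TYPE('f)"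
proof -
  have "\<exists>!m. CARD('f) = CHAR('f) ^ m"
  proof (rule ex_ex1I)
    show "\<exists>m. CARD('f) = CHAR('f) ^ m" by (rule card_finite_field_prime_power)
    show "m = m'" if "CARD('f) = CHAR('f) ^ m" "CARD('f) = CHAR('f) ^ m'" for m m'
      using that prime_gt_1_nat[OF CHAR_prime, where ?'a1 = 'f]
      by (metis CHAR_prime power_inject_exp prime_gt_1_nat)
  qed
  then show ?thesis unfolding prime_degree_def by (rule theI')
qed

text \<open>The trace takes values in the prime field, so the choice in \<^const>\<open>prime_field_over_p\<close>
  is a choice of an actual representative.\<close>

lemma prime_trace_in_prime_field: "\<exists>k::int. of_int k = prime_trace (x::'f::finite_field)"
proof -
  define p where "p = CHAR('f)"
  define m where "m = prime_degree TYPE('f)"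
  have p: "prime p" unfolding p_def by simp
  have p1: "1 < p" by (rule prime_gt_1_nat[OF p])
  have xq: "x ^ (p ^ m) = x"
    using finite_field_power_card_eq_same[of x] by (simp add: card_finite_field p_def m_def)
  have "prime_trace x ^ p = (\<Sum>i<m. (x ^ (p ^ i)) ^ p)"
    unfolding prime_trace_def m_def p_def by (rule freshmans_dream_sum) auto
  also have "\<dots> = (\<Sum>i<m. x ^ (p ^ Suc i))"
    by (simp add: power_mult[symmetric] mult.commute)
  also have "\<dots> = prime_trace x"
    using sum.lessThan_Suc_shift[of "\<lambda>i. x ^ (p ^ i)" m]
      sum.lessThan_Suc[of "\<lambda>i. x ^ (p ^ i)" m] xq
    unfolding prime_trace_def m_def p_def by (simp add: add.commute)
  finally have tp: "prime_trace x ^ p = prime_trace x" .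
  define P :: "'f poly" where "P = monom 1 p - monom 1 1"
  have cP: "coeff P p = 1" unfolding P_def using p1 by simp
  then have P0: "P \<noteq> 0" by auto
  have dP: "degree P \<le> p" unfolding P_def using p1
    by (intro degree_diff_le order.trans[OF degree_monom_le]) auto
  have roots: "card {z. poly P z = 0} \<le> p"
    using card_poly_roots_bound[OF P0] dP by linarith
  have fr: "(of_nat k :: 'f) ^ p = of_nat k" for k
  proof (induction k)
    case 0
    then show ?case using p1 by simp
  next
    case (Suc k)
    have "(1 + of_nat k :: 'f) ^ p = 1 ^ p + of_nat k ^ p"
      by (rule freshmans_dream) (simp_all add: p_def)
    then show ?case using Suc by simp
  qed
  have sub: "(of_nat :: nat \<Rightarrow> 'f) ` {..<p} \<subseteq> {z. poly P z = 0}"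
    using fr by (auto simp: P_def poly_monom)
  have inj: "inj_on (of_nat :: nat \<Rightarrow> 'f) {..<p}"
  proof (rule inj_onI)
    fix i j assume ij: "i \<in> {..<p}" "j \<in> {..<p}" "(of_nat i :: 'f) = of_nat j"
    then have "(of_int (int i - int j) :: 'f) = 0" by simp
    then have "int p dvd int i - int j" by (simp only: of_int_eq_0_iff_char_dvd p_def)
    then have "int i mod int p = int j mod int p" by (simp add: mod_eq_dvd_iff)
    then show "i = j" using ij by simp
  qed
  have "(of_nat :: nat \<Rightarrow> 'f) ` {..<p} = {z. poly P z = 0}"
    by (rule card_seteq) (use sub roots inj in \<open>auto simp: card_image\<close>)
  moreover have "poly P (prime_trace x) = 0" using tp by (simp add: P_def poly_monom)
  ultimately obtain k where "prime_trace x = of_nat k" by blast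
  then show ?thesis by (metis of_int_of_nat_eq)
qed

lemma prime_field_over_p_of_int:
  "prime_field_over_p (of_int k :: 'f::finite_field) = ratmodint_of (of_int k / of_nat CHAR('f))"
proof -
  define l :: int where "l = (SOME l::int. of_int l = (of_int k :: 'f))"
  have "of_int l = (of_int k :: 'f)" unfolding l_def by (rule someI_ex) blast
  then have "(of_int (l - k) :: 'f) = 0" by simp
  then have "int CHAR('f) dvd l - k" by (simp only: of_int_eq_0_iff_char_dvd)
  then obtain c where "l - k = int CHAR('f) * c" by blast
  then have "(of_int (l - k) :: rat) = of_int (int CHAR('f) * c)" by (rule arg_cong)
  then have "(of_int l :: rat) - of_int k = of_nat CHAR('f) * of_int c" by simp
  then have "(of_int l / of_nat CHAR('f) :: rat) - of_int k / of_nat CHAR('f) = of_int c"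
    by (simp add: diff_divide_distrib[symmetric])
  then show ?thesis
    unfolding prime_field_over_p_def l_def[symmetric] ratmodint.abs_eq_iff by simp
qed


section \<open>Types and self-dual codes\<close>

definition field_automorphism :: "('f::field \<Rightarrow> 'f) \<Rightarrow> bool" where
  "field_automorphism \<sigma> \<longleftrightarrow> bij \<sigma> \<and> \<sigma> 1 = 1 \<and>
     (\<forall>x y. \<sigma> (x + y) = \<sigma> x + \<sigma> y) \<and> (\<forall>x y. \<sigma> (x * y) = \<sigma> x * \<sigma> y)"

definition conjugation :: "('f::field \<Rightarrow> 'f) \<Rightarrow> bool" where
  "conjugation bar \<longleftrightarrow> bar = id \<or> (field_automorphism bar \<and> bar \<noteq> id \<and> bar \<circ> bar = id)"

definition code_type :: "('f::finite_field \<Rightarrow> 'f) \<Rightarrow> ('f \<Rightarrow> ratmodint) set \<Rightarrow> bool" where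
  "code_type bar \<Phi> \<longleftrightarrow>
     (\<forall>\<phi>\<in>\<Phi>. \<phi> 0 = 0) \<and>
     (\<lambda>_. 0) \<in> \<Phi> \<and>
     (\<forall>\<phi>\<in>\<Phi>. \<forall>\<psi>\<in>\<Phi>. (\<lambda>x. \<phi> x + \<psi> x) \<in> \<Phi>) \<and>
     (\<forall>\<phi>\<in>\<Phi>. (\<lambda>x. - \<phi> x) \<in> \<Phi>) \<and>
     (\<forall>\<phi>\<in>\<Phi>. \<exists>r. \<forall>x y. \<phi> (x + y) - \<phi> x - \<phi> y = trace_form bar r x y) \<and>
     (\<forall>\<phi>\<in>\<Phi>. \<forall>r. (\<lambda>x. \<phi> (r * x)) \<in> \<Phi>) \<and>
     (\<forall>r. (\<lambda>x. trace_form bar r x x) \<in> \<Phi>)"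

definition code_form :: "('f \<Rightarrow> 'f) \<Rightarrow> 'f::field ^ 'N \<Rightarrow> 'f ^ 'N \<Rightarrow> 'f" where
  "code_form bar x y = (\<Sum>i\<in>UNIV. x $ i * bar (y $ i))"

definition dual_code :: "('f \<Rightarrow> 'f) \<Rightarrow> ('f::field ^ 'N) set \<Rightarrow> ('f ^ 'N) set" where
  "dual_code bar C = {x. \<forall>c\<in>C. code_form bar x c = 0}"

definition codes ::
  "('f::finite_field \<Rightarrow> 'f) \<Rightarrow> ('f \<Rightarrow> ratmodint) set \<Rightarrow> ('f ^ 'N) set set" where
  "codes bar \<Phi> = {C. vec.subspace C \<and> C = dual_code bar C \<and>
     (\<forall>c\<in>C. \<forall>\<phi>\<in>\<Phi>. (\<Sum>i\<in>UNIV. \<phi> (c $ i)) = 0)}"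


section \<open>Equivalence of codes\<close>

text \<open>The coordinate at position \<open>i\<close> moves to position \<open>\<pi> i\<close>.\<close>

definition permute_code :: "('N \<Rightarrow> 'N) \<Rightarrow> ('f ^ 'N) set \<Rightarrow> ('f ^ 'N) set" where
  "permute_code \<pi> C = (\<lambda>c. \<chi> i. c $ inv \<pi> i) ` C"

definition code_equiv :: "(('f ^ 'N) set \<times> ('f ^ 'N) set) set" where
  "code_equiv = {(C, D). \<exists>\<pi>. \<pi> permutes UNIV \<and> permute_code \<pi> C = D}"

definition Aut :: "('f ^ 'N) set \<Rightarrow> ('N \<Rightarrow> 'N) set" where
  "Aut C = {\<pi>. \<pi> permutes UNIV \<and> permute_code \<pi> C = C}"

definition code_classes ::
  "('f::finite_field \<Rightarrow> 'f) \<Rightarrow> ('f \<Rightarrow> ratmodint) set \<Rightarrow> ('f ^ 'N) set set set" where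
  "code_classes bar \<Phi> = codes bar \<Phi> // code_equiv"

definition class_rep :: "('f ^ 'N) set set \<Rightarrow> ('f ^ 'N) set" where
  "class_rep X = (SOME C. C \<in> X)"


section \<open>The Hermitian space\<close>

text \<open>
  There are only finitely many sets of sets of vectors, so they may serve as the coordinates of a
  complex coordinate space. The space with basis the classes of codes in the family is the span of
  the corresponding standard basis vectors.
\<close>

definition class_vec :: "('f::finite ^ 'N) set \<Rightarrow> complex ^ (('f ^ 'N) set set)" where
  "class_vec C = axis (code_equiv `` {C}) 1"

definition code_space ::
  "('f::finite_field \<Rightarrow> 'f) \<Rightarrow> ('f \<Rightarrow> ratmodint) set \<Rightarrow> (complex ^ (('f ^ 'N) set set)) set" where
  "code_space bar \<Phi> = vec.span (class_vec ` codes bar \<Phi>)"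

text \<open>Linear in the first and antilinear in the second argument.\<close>

definition code_inner ::
  "('f::finite_field \<Rightarrow> 'f) \<Rightarrow> ('f \<Rightarrow> ratmodint) set \<Rightarrow>
   complex ^ (('f ^ 'N) set set) \<Rightarrow> complex ^ (('f ^ 'N) set set) \<Rightarrow> complex" where
  "code_inner bar \<Phi> v w =
     (\<Sum>X\<in>code_classes bar \<Phi>. of_nat (card (Aut (class_rep X))) * v $ X * cnj (w $ X))"


section \<open>Neighbors and the Kneser-Hecke operators\<close>

definition neighbors :: "nat \<Rightarrow> ('f::field ^ 'N) set \<Rightarrow> ('f ^ 'N) set \<Rightarrow> bool" where
  "neighbors k C D \<longleftrightarrow> vec.dim (C \<inter> D) + k = vec.dim C"

definition kneser_hecke ::
  "('f::finite_field \<Rightarrow> 'f) \<Rightarrow> ('f \<Rightarrow> ratmodint) set \<Rightarrow> nat \<Rightarrow>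
   complex ^ (('f ^ 'N) set set) \<Rightarrow> complex ^ (('f ^ 'N) set set)" where
  "kneser_hecke bar \<Phi> k v =
     (\<Sum>X\<in>code_classes bar \<Phi>.
        v $ X *s (\<Sum>D | D \<in> codes bar \<Phi> \<and> neighbors k D (class_rep X). class_vec D))"


section \<open>The definitions do not depend on representatives\<close>

lemma permute_code_compose:
  assumes "\<pi> permutes UNIV" "\<rho> permutes UNIV"
  shows "permute_code \<pi> (permute_code \<rho> C) = permute_code (\<pi> \<circ> \<rho>) C"
  using assms unfolding permute_code_def
  by (simp add: image_image o_inv_distrib permutes_bij)

lemma permute_code_id: "permute_code id C = C"
  unfolding permute_code_def by simp

lemma permute_code_inv:
  assumes "\<pi> permutes UNIV"
  shows "permute_code (inv \<pi>) (permute_code \<pi> C) = C"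
    "permute_code \<pi> (permute_code (inv \<pi>) C) = C"
  using assms by (simp_all add: permute_code_compose permutes_inv permutes_inv_o permute_code_id)

lemma equiv_code_equiv: "equiv UNIV code_equiv"
proof (rule equivI)
  show "code_equiv \<subseteq> UNIV \<times> UNIV" by simp
  show "refl code_equiv"
    unfolding refl_on_def code_equiv_def using permute_code_id permutes_id by blast
  show "sym code_equiv"
  proof (rule symI)
    fix C D assume "(C, D) \<in> code_equiv"
    then obtain \<pi> where "\<pi> permutes UNIV" "permute_code \<pi> C = D"
      unfolding code_equiv_def by auto
    then have "inv \<pi> permutes UNIV" "permute_code (inv \<pi>) D = C"
      using permutes_inv permute_code_inv(1) by blast+
    then show "(D, C) \<in> code_equiv" unfolding code_equiv_def by blast
  qed
  show "trans code_equiv"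
  proof (rule transI)
    fix C D E assume "(C, D) \<in> code_equiv" "(D, E) \<in> code_equiv"
    then obtain \<pi> \<rho> where "\<pi> permutes UNIV" "permute_code \<pi> C = D"
      "\<rho> permutes UNIV" "permute_code \<rho> D = E"
      unfolding code_equiv_def by auto
    then have "\<rho> \<circ> \<pi> permutes UNIV" "permute_code (\<rho> \<circ> \<pi>) C = E"
      using permutes_compose permute_code_compose by blast+
    then show "(C, E) \<in> code_equiv" unfolding code_equiv_def by blast
  qed
qed

lemma class_rep_equiv: "(C, class_rep (code_equiv `` {C})) \<in> code_equiv"
proof -
  have "C \<in> code_equiv `` {C}" by (rule equiv_class_self[OF equiv_code_equiv UNIV_I])
  then have "class_rep (code_equiv `` {C}) \<in> code_equiv `` {C}"
    unfolding class_rep_def by (rule someI)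
  then show ?thesis by simp
qed

lemma class_vec_permute:
  assumes "\<pi> permutes UNIV"
  shows "class_vec (permute_code \<pi> C) = class_vec C"
proof -
  have "(C, permute_code \<pi> C) \<in> code_equiv"
    unfolding code_equiv_def using assms by blast
  then show ?thesis
    unfolding class_vec_def using equiv_class_eq[OF equiv_code_equiv] by metis
qed

lemma permute_vec_linear:
  "Vector_Spaces.linear (*s) (*s) (\<lambda>c::'f::field^'N. \<chi> i. c $ \<rho> i)"
  by unfold_locales (simp_all add: vec_eq_iff algebra_simps)

lemma permute_vec_inj:
  assumes "\<pi> permutes UNIV"
  shows "inj (\<lambda>c::'f^'N. \<chi> i. c $ inv \<pi> i)"
proof (rule injI)
  fix x y :: "'f^'N"
  assume "(\<chi> i. x $ inv \<pi> i) = (\<chi> i. y $ inv \<pi> i)"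
  then have "x $ inv \<pi> i = y $ inv \<pi> i" for i by (simp add: vec_eq_iff)
  from this[of "\<pi> _"] show "x = y" using assms by (simp add: vec_eq_iff permutes_inverses)
qed

lemma dim_permute_code:
  fixes C :: "('f::field ^ 'N) set"
  assumes "\<pi> permutes UNIV"
  shows "vec.dim (permute_code \<pi> C) = vec.dim C"
  unfolding permute_code_def
  by (rule vec.dim_image_eq[OF permute_vec_linear])
    (rule inj_on_subset[OF permute_vec_inj[OF assms]], simp)

lemma neighbors_permute:
  assumes "\<pi> permutes UNIV"
  shows "neighbors k (permute_code \<pi> C) (permute_code \<pi> D) \<longleftrightarrow> neighbors k C D"
proof -
  have "permute_code \<pi> C \<inter> permute_code \<pi> D = permute_code \<pi> (C \<inter> D)"
    unfolding permute_code_def by (rule image_Int[symmetric, OF permute_vec_inj[OF assms]])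
  then show ?thesis unfolding neighbors_def by (simp add: dim_permute_code[OF assms])
qed

lemma sum_permute:
  assumes "\<pi> permutes (UNIV :: 'N::finite set)"
  shows "(\<Sum>i\<in>UNIV. g (inv \<pi> i)) = (\<Sum>i\<in>UNIV. g i)"
  using sum.permute[OF permutes_inv[OF assms], of g] by (simp add: comp_def)

lemma permute_code_codes:
  fixes C :: "('f::finite_field ^ 'N) set"
  assumes pi: "\<pi> permutes UNIV" and C: "C \<in> codes bar \<Phi>"
  shows "permute_code \<pi> C \<in> codes bar \<Phi>"
proof -
  let ?f = "\<lambda>c::'f^'N. \<chi> i. c $ inv \<pi> i"
  have form: "code_form bar (?f x) (?f y) = code_form bar x y" for x y :: "'f^'N"
    unfolding code_form_def using sum_permute[OF pi, of "\<lambda>i. x $ i * bar (y $ i)"] by simp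
  have surj: "\<exists>y. x = ?f y" for x :: "'f^'N"
    by (rule exI[of _ "\<chi> i. x $ \<pi> i"]) (simp add: vec_eq_iff permutes_inverses[OF pi])
  have sub: "vec.subspace C" and dual: "C = dual_code bar C"
    and ty: "\<And>c \<phi>. c \<in> C \<Longrightarrow> \<phi> \<in> \<Phi> \<Longrightarrow> (\<Sum>i\<in>UNIV. \<phi> (c $ i)) = 0"
    using C unfolding codes_def by auto
  have mem: "?f y \<in> permute_code \<pi> C \<longleftrightarrow> y \<in> C" for y
    unfolding permute_code_def using permute_vec_inj[OF pi] by (rule inj_image_mem_iff)
  have "?f y \<in> permute_code \<pi> C \<longleftrightarrow> ?f y \<in> dual_code bar (permute_code \<pi> C)" for y
  proof -
    have "?f y \<in> dual_code bar (permute_code \<pi> C) \<longleftrightarrow> (\<forall>c\<in>C. code_form bar y c = 0)"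
      unfolding dual_code_def permute_code_def by (simp add: form)
    also have "\<dots> \<longleftrightarrow> y \<in> dual_code bar C" unfolding dual_code_def by simp
    also have "\<dots> \<longleftrightarrow> y \<in> C" using dual by simp
    finally show ?thesis using mem by simp
  qed
  then have "permute_code \<pi> C = dual_code bar (permute_code \<pi> C)"
    using surj by (metis subsetI subset_antisym)
  moreover have "vec.subspace (permute_code \<pi> C)"
    unfolding permute_code_def
    by (rule vec.linear_subspace_image[OF permute_vec_linear sub])
  moreover have "(\<Sum>i\<in>UNIV. \<phi> (c $ i)) = 0" if "c \<in> permute_code \<pi> C" "\<phi> \<in> \<Phi>" for c \<phi>
  proof -
    obtain d where d: "d \<in> C" "c = ?f d"
      using \<open>c \<in> permute_code \<pi> C\<close> unfolding permute_code_def by blast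
    show ?thesis using sum_permute[OF pi, of "\<lambda>i. \<phi> (d $ i)"]
        ty[OF d(1) \<open>\<phi> \<in> \<Phi>\<close>] d(2) by simp
  qed
  ultimately show ?thesis unfolding codes_def by blast
qed

lemma permute_code_codes_iff:
  assumes "\<pi> permutes UNIV"
  shows "permute_code \<pi> C \<in> codes bar \<Phi> \<longleftrightarrow> C \<in> codes bar \<Phi>"
  using permute_code_codes[OF assms] permute_code_codes[OF permutes_inv[OF assms]]
    permute_code_inv(1)[OF assms] by metis

lemma card_Aut_permute:
  assumes pi: "\<pi> permutes UNIV"
  shows "card (Aut (permute_code \<pi> C)) = card (Aut C)"
proof -
  have "bij_betw (\<lambda>\<rho>. \<pi> \<circ> \<rho> \<circ> inv \<pi>) (Aut C) (Aut (permute_code \<pi> C))"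
  proof (rule bij_betw_byWitness[where f' = "\<lambda>\<rho>. inv \<pi> \<circ> \<rho> \<circ> \<pi>"])
    have *: "\<pi> \<circ> (inv \<pi> \<circ> \<rho>) = \<rho>" "inv \<pi> \<circ> (\<pi> \<circ> \<rho>) = \<rho>" for \<rho> :: "'a \<Rightarrow> 'a"
      using pi by (auto simp: fun_eq_iff permutes_inverses)
    show "\<forall>a\<in>Aut C. inv \<pi> \<circ> (\<pi> \<circ> a \<circ> inv \<pi>) \<circ> \<pi> = a"
      using pi by (auto simp: fun_eq_iff permutes_inverses)
    show "\<forall>a\<in>Aut (permute_code \<pi> C). \<pi> \<circ> (inv \<pi> \<circ> a \<circ> \<pi>) \<circ> inv \<pi> = a"
      using pi by (auto simp: fun_eq_iff permutes_inverses)
    show "(\<lambda>\<rho>. \<pi> \<circ> \<rho> \<circ> inv \<pi>) ` Aut C \<subseteq> Aut (permute_code \<pi> C)"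
      unfolding Aut_def using pi
      by (auto simp: permute_code_compose[symmetric] permutes_compose permutes_inv permute_code_inv)
    show "(\<lambda>\<rho>. inv \<pi> \<circ> \<rho> \<circ> \<pi>) ` Aut (permute_code \<pi> C) \<subseteq> Aut C"
      unfolding Aut_def using pi
      by (auto simp: permute_code_compose[symmetric] permutes_compose permutes_inv permute_code_inv)
  qed
  then show ?thesis by (metis bij_betw_same_card)
qed

lemma class_rep_permute:
  obtains \<pi> where "\<pi> permutes UNIV" "class_rep (code_equiv `` {C}) = permute_code \<pi> C"
  using class_rep_equiv[of C] unfolding code_equiv_def by auto

lemma card_Aut_class_rep: "card (Aut (class_rep (code_equiv `` {C}))) = card (Aut C)"
  by (metis class_rep_permute card_Aut_permute)

lemma code_classes_finite: "finite (code_classes bar \<Phi>)"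
  by simp

lemma class_in_code_classes: "C \<in> codes bar \<Phi> \<Longrightarrow> code_equiv `` {C} \<in> code_classes bar \<Phi>"
  unfolding code_classes_def by (rule quotientI)

theorem code_inner_class_vec:
  assumes "C \<in> codes bar \<Phi>" "D \<in> codes bar \<Phi>"
  shows "code_inner bar \<Phi> (class_vec C) (class_vec D) =
    (if code_equiv `` {C} = code_equiv `` {D} then of_nat (card (Aut C)) else 0)"
proof -
  let ?c = "code_equiv `` {C}" and ?d = "code_equiv `` {D}"
  have "code_inner bar \<Phi> (class_vec C) (class_vec D) =
      (\<Sum>X\<in>code_classes bar \<Phi>. if X = ?c then
        (if ?c = ?d then of_nat (card (Aut (class_rep ?c))) else 0) else 0)"
    unfolding code_inner_def class_vec_def axis_def by (intro sum.cong) auto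
  also have "\<dots> = (if ?c = ?d then of_nat (card (Aut (class_rep ?c))) else 0)"
    using class_in_code_classes[OF assms(1)] by (simp add: sum.delta code_classes_finite)
  finally show ?thesis by (simp only: card_Aut_class_rep)
qed

theorem kneser_hecke_class_vec:
  assumes C: "C \<in> codes bar \<Phi>"
  shows "kneser_hecke bar \<Phi> k (class_vec C) =
    (\<Sum>D | D \<in> codes bar \<Phi> \<and> neighbors k D C. class_vec D)"
proof -
  let ?c = "code_equiv `` {C}"
  let ?S = "\<lambda>X. \<Sum>D | D \<in> codes bar \<Phi> \<and> neighbors k D (class_rep X). class_vec D"
  obtain \<pi> where pi: "\<pi> permutes UNIV" and rep: "class_rep ?c = permute_code \<pi> C"
    by (rule class_rep_permute)
  have "kneser_hecke bar \<Phi> k (class_vec C) =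
      (\<Sum>X\<in>code_classes bar \<Phi>. if X = ?c then ?S ?c else 0)"
    unfolding kneser_hecke_def by (intro sum.cong) (auto simp: class_vec_def axis_def)
  also have "\<dots> = ?S ?c"
    using class_in_code_classes[OF C] by (simp add: sum.delta code_classes_finite)
  also have "\<dots> = (\<Sum>D | D \<in> codes bar \<Phi> \<and> neighbors k D C. class_vec D)"
  proof -
    have nb: "neighbors k (permute_code (inv \<pi>) D) C \<longleftrightarrow> neighbors k D (permute_code \<pi> C)" for D
      using neighbors_permute[OF pi, of k "permute_code (inv \<pi>) D" C]
      unfolding permute_code_inv(2)[OF pi] by (rule sym)
    show ?thesis
      unfolding rep
      by (rule sum.reindex_bij_witness[of _ "permute_code \<pi>" "permute_code (inv \<pi>)"])
        (simp_all add: permute_code_inv[OF pi] permute_code_codes_iff[OF pi] nb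
          permute_code_codes_iff[OF permutes_inv[OF pi]] neighbors_permute[OF pi]
          class_vec_permute[OF permutes_inv[OF pi]])
  qed
  finally show ?thesis .
qed

end

theory Submission
  imports Defs
begin

text \<open>
  All self-dual codes have the same dimension, so being \<open>k\<close>-neighbors is a symmetric relation. The
  coordinate permutations \<open>\<pi>\<close> for which \<open>\<pi> D\<close> is a \<open>k\<close>-neighbor of \<open>C\<close> number \<open>|Aut(D)|\<close>
  times the number of \<open>k\<close>-neighbors of \<open>C\<close> in \<open>[D]\<close>. Replacing \<open>\<pi>\<close> by its inverse exchanges the
  roles of \<open>C\<close> and \<open>D\<close>, so the matrix of the form \<open>(T\<^sub>k v, w)\<close> is symmetric; being also
  real, it is Hermitian.
\<close>

section \<open>Rank and nullity on a subspace\<close>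

lemma (in vector_space) span_Int_span_eq_0:
  assumes "independent (A \<union> B)" "A \<inter> B = {}"
  shows "span A \<inter> span B = {0}"
proof -
  have "x = 0" if x: "x \<in> span A" "x \<in> span B" for x
  proof -
    have ind: "independent A" "independent B"
      using independent_mono[OF assms(1)] by auto
    have "representation A x = representation (A \<union> B) x"
      "representation B x = representation (A \<union> B) x"
      using x by (auto intro!: representation_extend[OF assms(1), symmetric])
    \<comment> \<open>Both representations of \<open>x\<close> agree with the one over the union, so
      its support lies in \<open>A\<close> and in \<open>B\<close>, which are disjoint.\<close>
    then have "representation A x b = 0" for b
      using assms(2) representation_ne_zero
      by (metis disjoint_iff)
    then show ?thesis
      using sum_nonzero_representation_eq[OF ind(1) x(1)] by simp
  qed
  then show ?thesis using span_zero by blast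
qed

text \<open>A basis \<open>B\<close> of the kernel is extended to a basis of \<open>S\<close>. The
  span of the added vectors \<open>W\<close> meets the kernel only in 0, so \<open>g\<close> is
  injective there and the image has dimension at least \<open>card W\<close>.\<close>

lemma dim_le_dim_image_plus_dim_kernel:
  fixes g :: "'f::field ^ 'N \<Rightarrow> 'f ^ 'M"
  assumes g: "Vector_Spaces.linear (*s) (*s) g" and S: "vec.subspace S"
  shows "vec.dim S \<le> vec.dim (g ` S) + vec.dim {x \<in> S. g x = 0}"
proof -
  let ?K = "{x \<in> S. g x = 0}"
  obtain B where B: "B \<subseteq> ?K" "vec.independent B" "?K \<subseteq> vec.span B" "card B = vec.dim ?K"
    using vec.basis_exists by blast
  obtain A where A: "B \<subseteq> A" "A \<subseteq> S" "vec.independent A" "S \<subseteq> vec.span A"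
    using vec.maximal_independent_subset_extend[of B S] B by blast
  define W where "W = A - B"
  have AW: "A = W \<union> B" "W \<inter> B = {}" unfolding W_def using A(1) by auto
  have finA: "finite A" using A(3) by (rule vec.finiteI_independent)
  have WS: "vec.span W \<subseteq> S"
    using A(2) AW S by (intro vec.span_minimal) auto
  have "vec.span W \<inter> ?K \<subseteq> {0}"
    using vec.span_Int_span_eq_0[of W B] A(3) AW B(3) by blast
  then have "inj_on g (vec.span W)"
    using vec.linear_inj_on_iff_eq_0[OF g vec.subspace_span] WS by blast
  then have "vec.dim W = vec.dim (g ` W)"
    using vec.dim_image_eq[OF g, of W] by simp
  also have "\<dots> \<le> vec.dim (g ` S)"
    using A(2) AW by (intro vec.dim_subset) auto
  finally have "card W \<le> vec.dim (g ` S)"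
    using vec.dim_eq_card_independent[of W] vec.independent_mono[OF A(3)] AW by auto
  moreover have "vec.dim S = card W + card B"
  proof -
    have "vec.dim S = card A"
      using vec.dim_unique[OF A(2) A(4) A(3) refl] .
    also have "\<dots> = card W + card B"
      using AW finA by (simp add: card_Un_disjoint)
    finally show ?thesis .
  qed
  ultimately show ?thesis using B(4) by simp
qed

section \<open>Self-dual codes have equal dimension\<close>

lemma conjugation_hom:
  assumes "conjugation bar"
  shows "bar 0 = 0" "bar (x + y) = bar x + bar y" "bar (x * y) = bar x * bar y"
proof -
  show add: "bar (x + y) = bar x + bar y" and "bar (x * y) = bar x * bar y" for x y
    using assms unfolding conjugation_def field_automorphism_def by auto
  have "bar 0 + bar 0 = bar 0 + 0" using add[of 0 0] by simp
  then show "bar 0 = 0" by (rule add_left_imp_eq)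
qed

text \<open>In its second argument the form is additive and linear up to \<open>bar\<close>, so the
  vectors \<open>y\<close> with \<open>code_form bar x y = 0\<close> form a subspace in the
  Hermitian case too.\<close>

lemma code_form_span_eq_0:
  assumes bar: "conjugation bar" and E: "\<And>e. e \<in> E \<Longrightarrow> code_form bar x e = 0"
    and y: "y \<in> vec.span E"
  shows "code_form bar x y = 0"
proof -
  have "vec.subspace {y. code_form bar x y = 0}"
    unfolding vec.subspace_def code_form_def
    by (auto simp: conjugation_hom[OF bar] algebra_simps sum.distrib simp flip: sum_distrib_left)
  then have "vec.span E \<subseteq> {y. code_form bar x y = 0}"
    using E by (intro vec.span_minimal) auto
  then show ?thesis using y by blast
qed

text \<open>The form induces a pairing of \<open>C / (C \<inter> D)\<close> with \<open>D / (C \<inter> D)\<close> that is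
  nondegenerate on the left.\<close>

lemma dim_self_dual_le:
  fixes C D :: "('f::field ^ 'N) set"
  assumes bar: "conjugation bar"
    and C: "vec.subspace C" "C = dual_code bar C"
    and D: "vec.subspace D" "D = dual_code bar D"
  shows "vec.dim C \<le> vec.dim D"
proof -
  obtain B where B: "B \<subseteq> C \<inter> D" "vec.independent B" "C \<inter> D \<subseteq> vec.span B"
      "card B = vec.dim (C \<inter> D)"
    using vec.basis_exists by blast
  obtain A where A: "B \<subseteq> A" "A \<subseteq> D" "vec.independent A" "D \<subseteq> vec.span A"
    using vec.maximal_independent_subset_extend[of B D] B by blast
  \<comment> \<open>\<open>E\<close> represents a basis of \<open>D\<close> modulo
    \<open>C \<inter> D\<close>.\<close>
  define E where "E = A - B"
  have finA: "finite A" using A(3) by (rule vec.finiteI_independent)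
  have dimD: "vec.dim D = card A"
    using vec.dim_unique[OF A(2) A(4) A(3) refl] .
  have cardE: "card E + card B = vec.dim D"
    unfolding dimD E_def using A(1) finA
    by (metis add.commute card_Diff_subset card_mono finite_subset le_add_diff_inverse)
  have "card E \<le> CARD('N)"
    using cardE vec.dim_subset_UNIV[of D] by (simp add: vec.dimension_def card_cart_basis)
  \<comment> \<open>The coordinates in \<open>J\<close> will index \<open>E\<close>, so that the
    values of the form on \<open>E\<close> fit into a vector of the ambient space.\<close>
  then obtain J :: "'N set" where J: "card J = card E"
    using obtain_subset_with_card_n[of "card E" "UNIV :: 'N set"] by blast
  moreover have "finite E" unfolding E_def using finA by simp
  ultimately obtain h where h: "bij_betw h J E"
    using finite_same_card_bij[of J E] by auto
  define g :: "'f ^ 'N \<Rightarrow> 'f ^ 'N"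
    where "g x = (\<chi> i. if i \<in> J then code_form bar x (h i) else 0)" for x
  have g: "Vector_Spaces.linear (*s) (*s) g"
    by unfold_locales
      (auto simp: g_def code_form_def vec_eq_iff algebra_simps sum.distrib sum_distrib_left)
  \<comment> \<open>A vector of \<open>C\<close> is orthogonal to \<open>B\<close>, which lies in
    \<open>C\<close>. If \<open>g\<close> kills it, it is orthogonal to \<open>E\<close> as well,
    hence to all of \<open>D\<close>, and so lies in the dual of \<open>D\<close>, which is
    \<open>D\<close>.\<close>
  have "{x \<in> C. g x = 0} \<subseteq> C \<inter> D"
  proof
    fix x assume "x \<in> {x \<in> C. g x = 0}"
    then have x: "x \<in> C" "g x = 0" by auto
    have "code_form bar x e = 0" if "e \<in> A" for e
    proof (cases "e \<in> B")
      case True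
      then show ?thesis using x(1) C(2) B(1) unfolding dual_code_def by blast
    next
      case False
      then have "e \<in> h ` J" using that h by (simp add: E_def bij_betw_def)
      then show ?thesis using x(2) by (auto simp: g_def vec_eq_iff split: if_splits)
    qed
    then have "code_form bar x d = 0" if "d \<in> D" for d
      using code_form_span_eq_0[OF bar] that A(4) by blast
    then have "x \<in> D" by (subst D(2)) (simp add: dual_code_def)
    then show "x \<in> C \<inter> D" using x by simp
  qed
  then have "vec.dim {x \<in> C. g x = 0} \<le> card B"
    unfolding B(4) by (rule vec.dim_subset)
  moreover have "vec.dim (g ` C) \<le> card E"
  proof -
    have "g ` C \<subseteq> {x. \<forall>i. i \<notin> J \<longrightarrow> x $ i = 0}" by (auto simp: g_def)
    from vec.dim_subset[OF this] show ?thesis unfolding dim_substandard_cart J .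
  qed
  ultimately show ?thesis
    using dim_le_dim_image_plus_dim_kernel[OF g C(1)] cardE by linarith
qed

text \<open>\<open>neighbors\<close> measures the codimension of the intersection in its first
  argument only; equal dimensions make this symmetric.\<close>

lemma neighbors_commute:
  assumes "conjugation bar" "C \<in> codes bar \<Phi>" "D \<in> codes bar \<Phi>"
  shows "neighbors k C D \<longleftrightarrow> neighbors k D C"
proof -
  have "vec.dim C = vec.dim D"
    using assms dim_self_dual_le[of bar C D] dim_self_dual_le[of bar D C]
    unfolding codes_def by (intro antisym) auto
  then show ?thesis unfolding neighbors_def by (simp add: Int_commute)
qed

section \<open>Counting neighbors through permutations\<close>

lemma finite_permutes_Collect [simp]: "finite {\<pi> :: 'N::finite \<Rightarrow> 'N. \<pi> permutes UNIV \<and> P \<pi>}"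
  by (rule finite_subset[OF _ finite_permutations[of UNIV]]) auto

text \<open>These permutations form the left coset of \<open>Aut D\<close> through any one of
  them.\<close>

lemma card_permutations_onto:
  fixes D :: "('f ^ 'N::finite) set"
  assumes "(D, E) \<in> code_equiv"
  shows "card {\<pi>. \<pi> permutes UNIV \<and> permute_code \<pi> D = E} = card (Aut D)"
proof -
  obtain \<rho> where \<rho>: "\<rho> permutes UNIV" "permute_code \<rho> D = E"
    using assms unfolding code_equiv_def by auto
  have "bij_betw (\<lambda>\<pi>. \<rho> \<circ> \<pi>) (Aut D) {\<pi>. \<pi> permutes UNIV \<and> permute_code \<pi> D = E}"
  proof (rule bij_betw_byWitness[where f' = "\<lambda>\<pi>. inv \<rho> \<circ> \<pi>"])
    show "\<forall>a\<in>Aut D. inv \<rho> \<circ> (\<rho> \<circ> a) = a"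
      using \<rho> by (auto simp: fun_eq_iff permutes_inverses)
    show "\<forall>a\<in>{\<pi>. \<pi> permutes UNIV \<and> permute_code \<pi> D = E}. \<rho> \<circ> (inv \<rho> \<circ> a) = a"
      using \<rho> by (auto simp: fun_eq_iff permutes_inverses)
    show "(\<lambda>\<pi>. \<rho> \<circ> \<pi>) ` Aut D \<subseteq> {\<pi>. \<pi> permutes UNIV \<and> permute_code \<pi> D = E}"
      unfolding Aut_def using \<rho>
      by (auto simp: permute_code_compose[symmetric] permutes_compose)
    show "(\<lambda>\<pi>. inv \<rho> \<circ> \<pi>) ` {\<pi>. \<pi> permutes UNIV \<and> permute_code \<pi> D = E} \<subseteq> Aut D"
      unfolding Aut_def using \<rho>
      by (auto simp: permute_code_compose[symmetric] permutes_compose permutes_inv permute_code_inv)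
  qed
  then show ?thesis by (metis bij_betw_same_card)
qed

text \<open>The permutations are sorted by the image of \<open>D\<close>; each code equivalent to
  \<open>D\<close> arises from exactly \<open>card (Aut D)\<close> of them.\<close>

lemma card_Aut_times_card_equiv:
  fixes D :: "('f::finite ^ 'N::finite) set"
  shows "card (Aut D) * card {E. (D, E) \<in> code_equiv \<and> P E} =
    card {\<pi>. \<pi> permutes UNIV \<and> P (permute_code \<pi> D)}"
proof -
  let ?S = "{E. (D, E) \<in> code_equiv \<and> P E}"
  have "{\<pi>. \<pi> permutes UNIV \<and> P (permute_code \<pi> D)} =
      (\<Union>E\<in>?S. {\<pi>. \<pi> permutes UNIV \<and> permute_code \<pi> D = E})"
    unfolding code_equiv_def by auto
  also have "card \<dots> = (\<Sum>E\<in>?S. card {\<pi>. \<pi> permutes UNIV \<and> permute_code \<pi> D = E})"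
    by (rule card_UN_disjoint) auto
  also have "\<dots> = card (Aut D) * card ?S"
    by (simp add: card_permutations_onto)
  finally show ?thesis by simp
qed

text \<open>Each side counts permutations, and inversion matches the two sets:
  \<open>permute_code \<pi> D\<close> neighbors \<open>C\<close> iff
  \<open>permute_code (inv \<pi>) C\<close> neighbors \<open>D\<close>.\<close>

lemma card_neighbors_commute:
  fixes C D :: "('f::finite_field ^ 'N::finite) set"
  assumes bar: "conjugation bar" and CD: "C \<in> codes bar \<Phi>" "D \<in> codes bar \<Phi>"
  shows "card (Aut D) * card {E. (D, E) \<in> code_equiv \<and> neighbors k E C} =
    card (Aut C) * card {E. (C, E) \<in> code_equiv \<and> neighbors k E D}"
proof -
  have flip: "neighbors k (permute_code (inv \<pi>) C) D \<longleftrightarrow> neighbors k (permute_code \<pi> D) C"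
    if \<pi>: "\<pi> permutes UNIV" for \<pi>
  proof -
    have "neighbors k (permute_code (inv \<pi>) C) D \<longleftrightarrow> neighbors k C (permute_code \<pi> D)"
      using neighbors_permute[OF \<pi>, of k "permute_code (inv \<pi>) C" D]
      unfolding permute_code_inv(2)[OF \<pi>] by (rule sym)
    also have "\<dots> \<longleftrightarrow> neighbors k (permute_code \<pi> D) C"
      using neighbors_commute[OF bar CD(1) permute_code_codes[OF \<pi> CD(2)]] .
    finally show ?thesis .
  qed
  have flip': "neighbors k (permute_code (inv \<pi>) D) C \<longleftrightarrow> neighbors k (permute_code \<pi> C) D"
    if "\<pi> permutes UNIV" for \<pi>
    using flip[OF permutes_inv[OF that]] permutes_inv_inv[OF that] by simp
  have "bij_betw inv {\<pi>. \<pi> permutes UNIV \<and> neighbors k (permute_code \<pi> D) C}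
      {\<pi>. \<pi> permutes UNIV \<and> neighbors k (permute_code \<pi> C) D}"
    by (rule bij_betw_byWitness[where f' = inv])
      (auto simp: permutes_inv_inv permutes_inv flip flip')
  then show ?thesis
    unfolding card_Aut_times_card_equiv by (rule bij_betw_same_card)
qed

section \<open>The matrix of the operator and self-adjointness\<close>

lemma code_classes_rep:
  assumes "X \<in> code_classes bar \<Phi>"
  shows "class_rep X \<in> codes bar \<Phi>" "code_equiv `` {class_rep X} = X"
proof -
  obtain C where C: "C \<in> codes bar \<Phi>" "X = code_equiv `` {C}"
    using assms unfolding code_classes_def by (rule quotientE)
  obtain \<pi> where "\<pi> permutes UNIV" "class_rep X = permute_code \<pi> C"
    unfolding C(2) by (rule class_rep_permute)
  then show "class_rep X \<in> codes bar \<Phi>" using permute_code_codes C(1) by metis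
  show "code_equiv `` {class_rep X} = X"
    using equiv_class_eq[OF equiv_code_equiv class_rep_equiv[of C]] C(2) by simp
qed

text \<open>For classes of the family, this is the matrix entry of the \<open>k\<close>-th operator
  in column \<open>X\<close> and row \<open>Y\<close>.\<close>

definition class_neighbors ::
  "nat \<Rightarrow> ('f::field ^ 'N) set set \<Rightarrow> ('f ^ 'N) set set \<Rightarrow> nat" where
  "class_neighbors k X Y =
     card {E. (class_rep Y, E) \<in> code_equiv \<and> neighbors k E (class_rep X)}"

lemma kneser_hecke_nth:
  fixes v :: "complex ^ (('f::finite_field ^ 'N::finite) set set)"
  assumes Y: "Y \<in> code_classes bar \<Phi>"
  shows "kneser_hecke bar \<Phi> k v $ Y =
    (\<Sum>X\<in>code_classes bar \<Phi>. v $ X * of_nat (class_neighbors k X Y))"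
proof -
  have "(\<Sum>D | D \<in> codes bar \<Phi> \<and> neighbors k D C. class_vec D $ Y) =
      complex_of_nat (card {E. (class_rep Y, E) \<in> code_equiv \<and> neighbors k E C})" for C
  proof -
    have eq: "Y = code_equiv `` {D} \<longleftrightarrow> (class_rep Y, D) \<in> code_equiv" for D
      using code_classes_rep(2)[OF Y] eq_equiv_class_iff[OF equiv_code_equiv, of "class_rep Y" D]
      by simp
    \<comment> \<open>Permutations preserve the family, so counting within the class
      \<open>Y\<close> already forces membership in \<open>codes\<close>.\<close>
    have cd: "D \<in> codes bar \<Phi>" if "(class_rep Y, D) \<in> code_equiv" for D
      using that code_classes_rep(1)[OF Y] permute_code_codes
      unfolding code_equiv_def by auto
    have "(\<Sum>D | D \<in> codes bar \<Phi> \<and> neighbors k D C. class_vec D $ Y) =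
        (\<Sum>D | D \<in> codes bar \<Phi> \<and> neighbors k D C.
          if (class_rep Y, D) \<in> code_equiv then 1 else (0::complex))"
      by (intro sum.cong refl) (simp add: class_vec_def axis_def eq)
    also have "\<dots> = (\<Sum>D | (D \<in> codes bar \<Phi> \<and> neighbors k D C) \<and>
        (class_rep Y, D) \<in> code_equiv. 1)"
      by (subst sum.inter_filter[symmetric]) auto
    also have "\<dots> = complex_of_nat (card {D. (D \<in> codes bar \<Phi> \<and> neighbors k D C) \<and>
        (class_rep Y, D) \<in> code_equiv})"
      by simp
    also have "{D. (D \<in> codes bar \<Phi> \<and> neighbors k D C) \<and> (class_rep Y, D) \<in> code_equiv} =
        {E. (class_rep Y, E) \<in> code_equiv \<and> neighbors k E C}"
      using cd by blast
    finally show ?thesis .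
  qed
  then show ?thesis
    unfolding kneser_hecke_def class_neighbors_def by simp
qed

lemma kneser_hecke_self_adjoint:
  fixes v w :: "complex ^ (('f::finite_field ^ 'N::finite) set set)"
  assumes "conjugation bar"
  shows "code_inner bar \<Phi> (kneser_hecke bar \<Phi> k v) w =
    code_inner bar \<Phi> v (kneser_hecke bar \<Phi> k w)"
proof -
  let ?K = "code_classes bar \<Phi> :: ('f ^ 'N) set set set"
  let ?a = "\<lambda>X. of_nat (card (Aut (class_rep X))) :: complex"
  let ?m = "\<lambda>X Y. of_nat (class_neighbors k X Y) :: complex"
  \<comment> \<open>Weighting the rows by automorphism group orders makes the matrix
    symmetric.\<close>
  have sym: "?a Y * ?m X Y = ?a X * ?m Y X" if "X \<in> ?K" "Y \<in> ?K" for X Y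
    unfolding class_neighbors_def of_nat_mult[symmetric] of_nat_eq_iff
    using card_neighbors_commute[OF assms] code_classes_rep(1) that by blast
  have "code_inner bar \<Phi> (kneser_hecke bar \<Phi> k v) w =
      (\<Sum>Y\<in>?K. \<Sum>X\<in>?K. ?a Y * ?m X Y * (v $ X * cnj (w $ Y)))"
    unfolding code_inner_def
    by (simp add: kneser_hecke_nth sum_distrib_left sum_distrib_right mult_ac)
  also have "\<dots> = (\<Sum>Y\<in>?K. \<Sum>X\<in>?K. ?a X * ?m Y X * (v $ X * cnj (w $ Y)))"
    by (intro sum.cong refl) (simp add: sym)
  also have "\<dots> = (\<Sum>X\<in>?K. \<Sum>Y\<in>?K. ?a X * ?m Y X * (v $ X * cnj (w $ Y)))"
    by (rule sum.swap)
  \<comment> \<open>The entries are natural numbers, so \<open>cnj\<close> fixes them when they are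
    moved to the second argument.\<close>
  also have "\<dots> = code_inner bar \<Phi> v (kneser_hecke bar \<Phi> k w)"
    unfolding code_inner_def
    by (simp add: kneser_hecke_nth sum_distrib_left sum_distrib_right mult_ac)
  finally show ?thesis .
qed

lemma linear_kneser_hecke: "Vector_Spaces.linear (*s) (*s) (kneser_hecke bar \<Phi> k)"
  by unfold_locales
    (simp_all add: kneser_hecke_def vec_eq_iff algebra_simps sum.distrib sum_distrib_left)

lemma kneser_hecke_in_code_space: "kneser_hecke bar \<Phi> k v \<in> code_space bar \<Phi>"
  unfolding kneser_hecke_def code_space_def
  by (intro vec.span_sum vec.span_scale) (auto intro: vec.span_base)

theorem theorem3:
  fixes bar :: "'f::finite_field \<Rightarrow> 'f"
    and \<Phi> :: "('f \<Rightarrow> ratmodint) set"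
    and T :: "complex ^ (('f ^ 'N) set set) \<Rightarrow> complex ^ (('f ^ 'N) set set)"
    and n k :: nat
  assumes "CARD('N::finite) = 2 * n"
    and "conjugation bar"
    and "code_type bar \<Phi>"
    and "k \<le> n"
    and "T = kneser_hecke bar \<Phi> k"
  shows "Vector_Spaces.linear (*s) (*s) T \<and>
    (\<forall>v\<in>code_space bar \<Phi>. T v \<in> code_space bar \<Phi>) \<and>
    (\<forall>v\<in>code_space bar \<Phi>. \<forall>w\<in>code_space bar \<Phi>.
       code_inner bar \<Phi> (T v) w = code_inner bar \<Phi> v (T w))"
  unfolding assms(5)
  using linear_kneser_hecke kneser_hecke_in_code_space kneser_hecke_self_adjoint[OF assms(2)]
  by blast

end
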